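(* There is a unimodular lattice $L$ in dimension $43$ having minimum norm $4$ with $\sigma(L)=19$.
   Context: A (Euclidean) lattice $L \subset \mathbb{R}^n$ in dimension $n$ (i.e. of full rank $n$) is unimodular if $L=L^*$, where $L^*=\{x\in\mathbb{R}^n \mid (x,y)\in\mathbb{Z}\text{ for all }y\in L\}$ and $(x,y)$ is the standard inner product. The norm of a vector $x$ is $(x,x)$ (the squared length), and the minimum norm $\min(L)$ is the smallest norm of a nonzero vector of $L$. A unimodular lattice is even if all its vectors have even norm, and odd otherwise; even unimodular lattices exist only in dimensions divisible by $8$, so a unimodular lattice in dimension $43$ is odd. For an odd unimodular lattice $L$, the even sublattice is $L_0=\{x\in L\mid (x,x)\in 2\mathbb{Z}\}$, the shadow is $S(L)=L_0^*\setminus L$, and $\sigma(L)=4\min(S(L))$, where $\min(S(L))$ is the minimum norm of a vector in $S(L)$. *)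

theory Defs
  imports "HOL-Analysis.Analysis"
begin

definition full_rank_lattice :: "'a::euclidean_space set \<Rightarrow> bool" where
  "full_rank_lattice L \<longleftrightarrow>
     (\<exists>B. independent B \<and> span B = UNIV \<and>
          L = {\<Sum>b\<in>B. of_int (c b) *\<^sub>R b | c :: 'a \<Rightarrow> int. True})"

definition dual_lattice :: "'a::euclidean_space set \<Rightarrow> 'a set" where
  "dual_lattice L = {x. \<forall>y\<in>L. x \<bullet> y \<in> \<int>}"

definition unimodular :: "'a::euclidean_space set \<Rightarrow> bool" where
  "unimodular L \<longleftrightarrow> full_rank_lattice L \<and> L = dual_lattice L"

text \<open>
  In lattice theory the norm of a vector is its squared length \<open>x \<bullet> x\<close>, not the
  Euclidean length \<open>norm x\<close>.  The zero vector is disregarded.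
  The same function serves for the shadow, which never contains the zero vector.
\<close>
definition min_norm :: "'a::euclidean_space set \<Rightarrow> real" where
  "min_norm S = (LEAST r. \<exists>x\<in>S. x \<noteq> 0 \<and> r = x \<bullet> x)"

definition even_sublattice :: "'a::euclidean_space set \<Rightarrow> 'a set" where
  "even_sublattice L = {x \<in> L. \<exists>k::int. x \<bullet> x = 2 * of_int k}"

text \<open>
  The shadow is a notion for odd unimodular lattices.  For an even unimodular \<open>L\<close> the
  formula gives the empty set, and then \<open>min_norm\<close> is an unspecified real; even
  unimodular lattices exist only in dimensions divisible by 8.
\<close>
definition shadow :: "'a::euclidean_space set \<Rightarrow> 'a set" where
  "shadow L = dual_lattice (even_sublattice L) - L"

definition shadow_sigma :: "'a::euclidean_space set \<Rightarrow> real" where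
  "shadow_sigma L = 4 * min_norm (shadow L)"

end

theory Submission
  imports Defs
begin

text \<open>
  The lattice comes from a self-dual code over the integers modulo 4 of length 43 by
  construction A.  Its residue code \<open>C\<close> is a doubly-even binary code of dimension 10 with all
  nonzero weights in \<open>{16, 20, 24, 28}\<close> and dual distance at least 4.

  Let \<open>t\<close> be twice a lattice vector.  If \<open>t\<close> has an odd coordinate, then it has at least 16
  of them, so the norm is at least \<open>16 / 4\<close>.  Otherwise \<open>t = 2 y\<close> with \<open>y\<close> modulo 2 in the dual
  of \<open>C\<close>, and a nonzero \<open>y\<close> has norm at least 4 since no dual word has weight 1, 2 or 3.

  The shadow is a translate \<open>s + L\<close>.  If \<open>u\<close> is twice a vector of it, then the
  coordinates in which \<open>u\<close> is odd form the complement of a codeword, so there are at least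
  \<open>43 - 28 = 15\<close> of them and \<open>u \<bullet> u \<ge> 15\<close>.  As \<open>u \<bullet> u\<close> is constant modulo 8 on the shadow and
  equals 19 for \<open>u = 2 s\<close>, it is at least 19.
\<close>

section \<open>Unimodular lattices and their shadows\<close>

text \<open>Expanding \<open>b i\<close> in the \<open>w j\<close> and vice versa shows that both families span the same
  lattice, which is therefore its own dual.\<close>

lemma unimodularI:
  fixes b w :: "nat \<Rightarrow> 'a::euclidean_space"
  assumes bb: "\<And>i j. i < DIM('a) \<Longrightarrow> j < DIM('a) \<Longrightarrow> b i \<bullet> b j \<in> \<int>"
    and ww: "\<And>i j. i < DIM('a) \<Longrightarrow> j < DIM('a) \<Longrightarrow> w i \<bullet> w j \<in> \<int>"
    and dual: "\<And>x. (\<Sum>j<DIM('a). (x \<bullet> w j) *\<^sub>R b j) = x"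
  shows "unimodular {\<Sum>i<DIM('a). of_int (c i) *\<^sub>R b i | c. True}"
    (is "unimodular ?L")
proof -
  let ?n = "DIM('a)"
  let ?B = "b ` {..<?n}"
  have "x \<in> span ?B" for x
  proof -
    have "(\<Sum>j<?n. (x \<bullet> w j) *\<^sub>R b j) \<in> span ?B"
      by (intro span_sum span_scale span_base) auto
    then show ?thesis using dual by simp
  qed
  then have span: "span ?B = UNIV" by auto
  \<comment> \<open>Injectivity of \<open>b\<close> has to be derived. A spanning set with at most
    \<open>?n\<close> elements is independent, so it has exactly \<open>?n\<close> elements, and
    then no two of the \<open>b i\<close> coincide.\<close>
  have le: "card ?B \<le> ?n" using card_image_le[of "{..<?n}" b] by simp
  have ind: "independent ?B"
    by (rule card_le_dim_spanning[where V = UNIV]) (use span le in \<open>auto simp: dim_UNIV\<close>)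
  have "card ?B = ?n"
    using ind span dim_span[of ?B] dim_eq_card_independent[OF ind] by (metis dim_UNIV)
  then have inj: "inj_on b {..<?n}" by (simp add: eq_card_imp_inj_on)
  have "?L = {\<Sum>v\<in>?B. of_int (c v) *\<^sub>R v | c. True}"
  proof (intro subset_antisym subsetI)
    fix x assume "x \<in> ?L"
    then obtain c where "x = (\<Sum>i<?n. of_int (c i) *\<^sub>R b i)" by auto
    then have "x = (\<Sum>v\<in>?B. of_int (c (the_inv_into {..<?n} b v)) *\<^sub>R v)"
      by (simp add: sum.reindex[OF inj] the_inv_into_f_f[OF inj])
    then show "x \<in> {\<Sum>v\<in>?B. of_int (c v) *\<^sub>R v | c. True}"
      by (intro CollectI exI[of _ "\<lambda>v. c (the_inv_into {..<?n} b v)"]) simp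
  next
    fix x assume "x \<in> {\<Sum>v\<in>?B. of_int (c v) *\<^sub>R v | c. True}"
    then obtain c where "x = (\<Sum>v\<in>?B. of_int (c v) *\<^sub>R v)" by auto
    then have "x = (\<Sum>i<?n. of_int (c (b i)) *\<^sub>R b i)"
      by (simp add: sum.reindex[OF inj])
    then show "x \<in> ?L" by (intro CollectI exI[of _ "\<lambda>i. c (b i)"]) simp
  qed
  then have full: "full_rank_lattice ?L"
    unfolding full_rank_lattice_def using ind span by (intro exI[of _ ?B]) simp
  have "?L \<subseteq> dual_lattice ?L"
    by (auto simp: dual_lattice_def inner_sum_left inner_sum_right
        intro!: Ints_sum Ints_mult bb)
  moreover have "dual_lattice ?L \<subseteq> ?L"
  proof
    fix x assume x: "x \<in> dual_lattice ?L"
    have "x \<bullet> w j \<in> \<int>" if j: "j < ?n" for j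
    proof -
      \<comment> \<open>The expansion \<open>dual\<close> is applied to \<open>w j\<close> itself:
        its coefficients are entries of the Gram matrix of the \<open>w i\<close>, hence integers,
        so \<open>w j\<close> lies in the lattice.\<close>
      obtain c where c: "of_int (c i) = w j \<bullet> w i" if "i < ?n" for i
      proof -
        have "\<forall>i. \<exists>m::int. i < ?n \<longrightarrow> of_int m = w j \<bullet> w i"
          using ww[OF j] by (metis Ints_cases)
        then show ?thesis using that by metis
      qed
      have "w j = (\<Sum>i<?n. of_int (c i) *\<^sub>R b i)"
        using dual[of "w j"] c by simp
      then have "w j \<in> ?L" by auto
      then show ?thesis using x by (auto simp: dual_lattice_def)
    qed
    then have "\<forall>j. \<exists>m::int. j < ?n \<longrightarrow> x \<bullet> w j = of_int m" by (metis Ints_cases)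
    then obtain c where "\<And>j. j < ?n \<Longrightarrow> x \<bullet> w j = of_int (c j)" by metis
    then have "x = (\<Sum>j<?n. of_int (c j) *\<^sub>R b j)" using dual[of x] by simp
    then show "x \<in> ?L" by auto
  qed
  ultimately show ?thesis unfolding unimodular_def using full by auto
qed

lemma unimodular_inner_Ints:
  assumes "unimodular L" "x \<in> L" "y \<in> L"
  shows "x \<bullet> y \<in> \<int>"
  using assms by (auto simp: unimodular_def dual_lattice_def)

lemma dual_lattice_diff:
  assumes "x \<in> dual_lattice S" "y \<in> dual_lattice S"
  shows "x - y \<in> dual_lattice S"
  using assms by (auto simp: dual_lattice_def inner_diff_left)

text \<open>In this normalisation the vector \<open>2 *\<^sub>R s\<close> is a characteristic vector of \<open>L\<close>.\<close>

lemma shadow_eq_translate: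
  assumes uni: "unimodular L" and s: "s \<notin> L"
    and char: "\<And>x. x \<in> L \<Longrightarrow> \<exists>k::int. 2 * (s \<bullet> x) - x \<bullet> x = 2 * of_int k"
  shows "shadow L = (\<lambda>x. s + x) ` L"
proof -
  have L: "L = dual_lattice L" using uni by (simp add: unimodular_def)
  have diff: "x - y \<in> L" if "x \<in> L" "y \<in> L" for x y
    using that dual_lattice_diff L by blast
  have s_even: "s \<bullet> y \<in> \<int>" if y: "y \<in> even_sublattice L" for y
  proof -
    obtain k :: int where k: "y \<bullet> y = 2 * of_int k" "y \<in> L"
      using y by (auto simp: even_sublattice_def)
    obtain m :: int where "2 * (s \<bullet> y) - y \<bullet> y = 2 * of_int m" using char k by blast
    then have "s \<bullet> y = of_int (k + m)" using k by simp
    then show ?thesis by (metis Ints_of_int)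
  qed
  have odd_norm: "\<exists>a::int. x \<bullet> x = 2 * of_int a + 1"
    if "x \<in> L" "x \<notin> even_sublattice L" for x
  proof -
    obtain n :: int where n: "x \<bullet> x = of_int n"
      using unimodular_inner_Ints[OF uni \<open>x \<in> L\<close> \<open>x \<in> L\<close>] by (metis Ints_cases)
    have "odd n"
    proof
      assume "even n"
      then obtain k where "n = 2 * k" by blast
      then have "x \<bullet> x = 2 * of_int k" using n by simp
      then show False using that by (auto simp: even_sublattice_def)
    qed
    then obtain a where "n = 2 * a + 1" by (rule oddE)
    then show ?thesis using n by (intro exI[of _ a]) simp
  qed
  show ?thesis
  proof (intro subset_antisym subsetI)
    fix z assume "z \<in> shadow L"
    then have z: "z \<in> dual_lattice (even_sublattice L)" "z \<notin> L" by (auto simp: shadow_def)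
    then have z_even: "z \<bullet> y \<in> \<int>" if "y \<in> even_sublattice L" for y
      using that by (auto simp: dual_lattice_def)
    obtain x1 where x1: "x1 \<in> L" "z \<bullet> x1 \<notin> \<int>" using z(2) L by (auto simp: dual_lattice_def)
    then have "x1 \<notin> even_sublattice L" using z_even by blast
    then obtain a where a: "x1 \<bullet> x1 = 2 * of_int a + 1" using odd_norm x1 by blast
    \<comment> \<open>Doubling a vector of odd norm gives one of even norm. So \<open>z\<close> has
      an integral product with \<open>x1 + x1\<close> but not with \<open>x1\<close>, which makes
      \<open>z \<bullet> x1\<close> half an odd integer.\<close>
    have neg: "- x1 \<in> L" using diff[OF x1(1) x1(1)] diff[OF _ x1(1), of 0] by simp
    have dbl: "x1 + x1 \<in> L" using diff[OF x1(1) neg] by simp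
    have "(x1 + x1) \<bullet> (x1 + x1) = 2 * of_int (4 * a + 2)"
      using a by (simp add: inner_add_left inner_add_right)
    then have "x1 + x1 \<in> even_sublattice L" using dbl unfolding even_sublattice_def by blast
    then obtain m :: int where m: "z \<bullet> (x1 + x1) = of_int m" using z_even by (metis Ints_cases)
    have "odd m"
    proof
      assume "even m"
      then obtain k where "m = 2 * k" by blast
      then have "z \<bullet> x1 = of_int k" using m by (simp add: inner_add_right)
      then show False using x1 by simp
    qed
    then obtain q where q: "m = 2 * q + 1" by (rule oddE)
    obtain k :: int where k: "2 * (s \<bullet> x1) - x1 \<bullet> x1 = 2 * of_int k" using char x1 by blast
    \<comment> \<open>Since \<open>x1 \<bullet> x1\<close> is odd, \<open>s \<bullet> x1\<close> is
      half an odd integer as well, and the two halves cancel.\<close>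
    have "(z - s) \<bullet> x1 = of_int (q - k - a)"
      using m q k a by (simp add: inner_diff_left inner_add_right)
    then have zs1: "(z - s) \<bullet> x1 \<in> \<int>" by (metis Ints_of_int)
    have "(z - s) \<bullet> y \<in> \<int>" if y: "y \<in> L" for y
    proof (cases "y \<in> even_sublattice L")
      case True
      then show ?thesis using z_even s_even by (simp add: inner_diff_left)
    next
      case False
      then obtain c where c: "y \<bullet> y = 2 * of_int c + 1" using odd_norm y by blast
      obtain d :: int where d: "y \<bullet> x1 = of_int d"
        using unimodular_inner_Ints[OF uni y x1(1)] by (metis Ints_cases)
      \<comment> \<open>Two vectors of odd norm differ by one of even norm, so \<open>x1\<close>
        represents the only nontrivial coset of the even sublattice, and testing
        \<open>z - s\<close> on it is enough.\<close>
      have "(y - x1) \<bullet> (y - x1) = 2 * of_int (a + c + 1 - d)"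
        using a c d by (simp add: inner_diff_left inner_diff_right inner_commute)
      then have e: "y - x1 \<in> even_sublattice L"
        using diff[OF y x1(1)] unfolding even_sublattice_def by blast
      have "(z - s) \<bullet> y = z \<bullet> (y - x1) - s \<bullet> (y - x1) + (z - s) \<bullet> x1"
        by (simp add: inner_diff_left inner_diff_right)
      then show ?thesis using z_even[OF e] s_even[OF e] zs1 by simp
    qed
    then have "z - s \<in> L" using L by (auto simp: dual_lattice_def)
    then show "z \<in> (\<lambda>x. s + x) ` L" by (intro image_eqI[of _ _ "z - s"]) auto
  next
    fix z assume "z \<in> (\<lambda>x. s + x) ` L"
    then obtain x where x: "x \<in> L" "z = s + x" by auto
    have "z \<notin> L" using diff[of z x] x s by auto
    moreover have "z \<in> dual_lattice (even_sublattice L)"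
      unfolding dual_lattice_def
    proof (intro CollectI ballI)
      fix y assume y: "y \<in> even_sublattice L"
      then have "y \<in> L" by (simp add: even_sublattice_def)
      then show "z \<bullet> y \<in> \<int>"
        using x s_even[OF y] unimodular_inner_Ints[OF uni x(1)] by (simp add: inner_add_left)
    qed
    ultimately show "z \<in> shadow L" by (simp add: shadow_def)
  qed
qed

text \<open>Modulo 2 the map taking \<open>x\<close> to
  \<open>2 * (s \<bullet> x) - x \<bullet> x\<close> is additive on integral vectors, because the
  cross terms carry a factor 2. So the congruence need only be checked on generators.\<close>

lemma characteristic_sum:
  fixes b :: "nat \<Rightarrow> 'a::real_inner" and c :: "nat \<Rightarrow> int"
  assumes bb: "\<And>i j. i < n \<Longrightarrow> j < n \<Longrightarrow> b i \<bullet> b j \<in> \<int>"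
    and char: "\<And>i. i < n \<Longrightarrow> \<exists>k::int. 2 * (s \<bullet> b i) - b i \<bullet> b i = 2 * of_int k"
    and "x = (\<Sum>i<n. of_int (c i) *\<^sub>R b i)"
  shows "\<exists>k::int. 2 * (s \<bullet> x) - x \<bullet> x = 2 * of_int k"
proof -
  let ?S = "\<lambda>m. \<Sum>i<m. of_int (c i) *\<^sub>R b i"
  have "\<exists>k::int. 2 * (s \<bullet> ?S m) - ?S m \<bullet> ?S m = 2 * of_int k" if "m \<le> n" for m
    using that
  proof (induction m)
    case 0
    show ?case by (intro exI[of _ 0]) simp
  next
    case (Suc m)
    then obtain k :: int where k: "2 * (s \<bullet> ?S m) - ?S m \<bullet> ?S m = 2 * of_int k" by auto
    have "?S m \<bullet> b m \<in> \<int>"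
      using Suc.prems by (auto simp: inner_sum_left intro!: Ints_sum Ints_mult bb)
    then obtain p :: int where p: "?S m \<bullet> b m = of_int p" by (rule Ints_cases)
    obtain q :: int where q: "b m \<bullet> b m = of_int q"
      using bb[of m m] Suc.prems by (metis Ints_cases Suc_le_lessD)
    obtain r :: int where r: "2 * (s \<bullet> b m) - b m \<bullet> b m = 2 * of_int r"
      using char Suc.prems by (meson Suc_le_lessD)
    \<comment> \<open>The linear term is multiplied by \<open>c m\<close> and the quadratic one by
      its square; they agree modulo 2.\<close>
    have "even (c m - c m * c m)" by simp
    then obtain h where h: "c m - c m * c m = 2 * h" by blast
    have "2 * (s \<bullet> ?S (Suc m)) - ?S (Suc m) \<bullet> ?S (Suc m) =
        (2 * (s \<bullet> ?S m) - ?S m \<bullet> ?S m) - 2 * of_int (c m) * (?S m \<bullet> b m)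
        + of_int (c m) * (2 * (s \<bullet> b m) - b m \<bullet> b m)
        + (of_int (c m) - of_int (c m) * of_int (c m)) * (b m \<bullet> b m)"
      by (simp add: inner_add_left inner_add_right inner_commute algebra_simps)
    also have "\<dots> = of_int (2 * k - 2 * c m * p + c m * (2 * r) + (c m - c m * c m) * q)"
      unfolding k p r unfolding q by simp
    also have "\<dots> = 2 * of_int (k - c m * p + c m * r + h * q)"
      unfolding h by simp
    finally show ?case by blast
  qed
  then show ?thesis using assms(3) by blast
qed

lemma min_norm_eqI:
  assumes "v \<in> S" "v \<noteq> 0" "v \<bullet> v = r" "\<And>x. x \<in> S \<Longrightarrow> x \<noteq> 0 \<Longrightarrow> r \<le> x \<bullet> x"
  shows "min_norm S = r"
  unfolding min_norm_def using assms by (intro Least_equality) auto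

section \<open>Half-integral coordinates\<close>

text \<open>An arbitrary but fixed numbering of the index type, through which vectors can be given
  by lists of integers.\<close>

definition coord :: "'n::finite \<Rightarrow> nat" where
  "coord = (SOME f. bij_betw f UNIV {..<CARD('n)})"

text \<open>Only arguments below \<open>CARD('n)\<close> are read, so \<open>(!)\<close> applied to
  a list of that length is a legitimate \<open>t\<close>.\<close>

definition half_vec :: "(nat \<Rightarrow> int) \<Rightarrow> real ^ 'n::finite" where
  "half_vec t = (\<chi> k. of_int (t (coord k)) / 2)"

lemma bij_coord: "bij_betw (coord :: 'n::finite \<Rightarrow> nat) UNIV {..<CARD('n)}"
proof -
  have "\<exists>f :: 'n \<Rightarrow> nat. bij_betw f UNIV {..<CARD('n)}"
    using ex_bij_betw_finite_nat[of "UNIV :: 'n set"] by (simp add: atLeast0LessThan)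
  then show ?thesis unfolding coord_def by (rule someI_ex)
qed

lemma coord_less: "coord (k :: 'n::finite) < CARD('n)"
  using bij_betwE[OF bij_coord] by auto

lemma coord_eq_iff: "coord k = coord l \<longleftrightarrow> k = l"
  using bij_coord by (auto simp: bij_betw_def inj_on_def)

lemma sum_coord: "(\<Sum>k\<in>UNIV. f (coord (k :: 'n::finite))) = (\<Sum>i<CARD('n). f i)"
  by (rule sum.reindex_bij_betw[OF bij_coord])

lemma inner_half_vec:
  "(half_vec s :: real ^ 'n::finite) \<bullet> half_vec t = of_int (\<Sum>i<CARD('n). s i * t i) / 4"
proof -
  have "(half_vec s :: real ^ 'n) \<bullet> half_vec t
      = (\<Sum>k\<in>UNIV. (\<lambda>i. of_int (s i * t i) / 4) (coord (k :: 'n)))"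
    by (simp add: inner_vec_def half_vec_def)
  also have "\<dots> = (\<Sum>i<CARD('n). of_int (s i * t i) / 4)"
    by (rule sum_coord)
  finally show ?thesis by (simp add: sum_divide_distrib)
qed

lemma sum_half_vec:
  "(\<Sum>i\<in>I. of_int (c i) *\<^sub>R half_vec (t i)) = half_vec (\<lambda>k. \<Sum>i\<in>I. c i * t i k)"
  by (simp add: half_vec_def vec_eq_iff sum_divide_distrib)

lemma add_half_vec: "half_vec s + half_vec t = half_vec (\<lambda>k. s k + t k)"
  by (simp add: half_vec_def vec_eq_iff add_divide_distrib)

lemma half_vec_eq_0: "half_vec t = (0 :: real ^ 'n::finite)" if "\<And>k. k < CARD('n) \<Longrightarrow> t k = 0"
  by (simp add: half_vec_def vec_eq_iff that[OF coord_less])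

text \<open>The assumption is the matrix identity \<open>W^T B = 4 I\<close>. The two halvings
  contribute the factor 1/4, which leaves the identity matrix.\<close>

lemma sum_dual_half_vec:
  assumes "\<And>k l. k < CARD('n) \<Longrightarrow> l < CARD('n) \<Longrightarrow>
    (\<Sum>j<m. w j k * b j l) = (if l = k then 4 else 0)"
  shows "(\<Sum>j<m. (x \<bullet> half_vec (w j)) *\<^sub>R half_vec (b j)) = (x :: real ^ 'n::finite)"
proof -
  have "(\<Sum>j<m. (x \<bullet> half_vec (w j)) *\<^sub>R half_vec (b j)) $ l = x $ l" for l :: 'n
  proof -
    have "(\<Sum>j<m. (x \<bullet> half_vec (w j)) *\<^sub>R half_vec (b j)) $ l
        = (\<Sum>j<m. \<Sum>k\<in>UNIV. x $ k * (of_int (w j (coord k) * b j (coord l)) / 4))"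
      by (simp add: half_vec_def inner_vec_def sum_distrib_right mult.assoc sum_divide_distrib)
    also have "\<dots> = (\<Sum>k\<in>UNIV. x $ k * (of_int (\<Sum>j<m. w j (coord k) * b j (coord l)) / 4))"
      by (subst sum.swap) (simp add: sum_distrib_left sum_divide_distrib)
    also have "\<dots> = (\<Sum>k\<in>UNIV. if k = l then x $ k else 0)"
      by (intro sum.cong refl)
        (simp add: assms[OF coord_less coord_less] coord_eq_iff)
    finally show ?thesis by simp
  qed
  then show ?thesis by (simp add: vec_eq_iff)
qed

lemma card_odd_le_sum_squares:
  fixes t :: "nat \<Rightarrow> int"
  shows "int (card {k. k < n \<and> odd (t k)}) \<le> (\<Sum>k<n. t k * t k)"
proof -
  have "int (card {k. k < n \<and> odd (t k)}) = (\<Sum>k | k < n \<and> odd (t k). 1)" by simp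
  also have "\<dots> = (\<Sum>k<n. if odd (t k) then 1 else 0)"
    using sum.inter_filter[of "{..<n}" "\<lambda>_. 1 :: int" "\<lambda>k. odd (t k)"] by simp
  also have "\<dots> \<le> (\<Sum>k<n. t k * t k)"
  proof (intro sum_mono)
    fix k
    have "t k = 0 \<or> 1 \<le> t k * t k"
      by (metis mult_eq_0_iff not_le zero_le_square zero_less_one_class.zero_less_one
          int_one_le_iff_zero_less order_less_le)
    then show "(if odd (t k) then 1 else 0) \<le> t k * t k" by auto
  qed
  finally show ?thesis .
qed

section \<open>Binary codes\<close>

fun dot :: "int list \<Rightarrow> int list \<Rightarrow> int" where
  "dot (x # xs) (y # ys) = x * y + dot xs ys"
| "dot _ _ = 0"

text \<open>Tests \<open>P\<close> on the whole coset of \<open>v\<close> modulo the binary code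
  generated by the rows, by branching on whether each row is added. Addition over the field with two
  elements is \<open>map2 (\<noteq>)\<close>.\<close>

fun all_comb :: "(bool list \<Rightarrow> bool) \<Rightarrow> bool list list \<Rightarrow> bool list \<Rightarrow> bool" where
  "all_comb P [] v = P v"
| "all_comb P (r # rs) v = (all_comb P rs v \<and> all_comb P rs (map2 (\<noteq>) v r))"

text \<open>Expresses that no selection of between 1 and \<open>d\<close> of the listed vectors sums
  to \<open>v\<close> modulo 2. For \<open>v\<close> zero and the columns of a generator matrix,
  this means that the dual distance exceeds \<open>d\<close>.\<close>

fun no_dep :: "nat \<Rightarrow> bool list \<Rightarrow> bool list list \<Rightarrow> bool" where
  "no_dep 0 v cs = True"
| "no_dep (Suc d) v [] = True"
| "no_dep (Suc d) v (c # cs) =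
    (c \<noteq> v \<and> no_dep (Suc d) v cs \<and> no_dep d (map2 (\<noteq>) v c) cs)"

lemma dot_eq_sum: "length xs = length ys \<Longrightarrow> dot xs ys = (\<Sum>k<length xs. xs ! k * ys ! k)"
proof (induction xs ys rule: dot.induct)
  case (1 x xs y ys)
  then show ?case by (simp add: sum.lessThan_Suc_shift del: sum.lessThan_Suc)
qed auto

text \<open>Modulo 2 an integer combination of the rows is the sum of those with odd coefficient,
  which is one branch of the recursion.\<close>

lemma all_combD:
  assumes "all_comb P (map (map odd) rs) v" "\<forall>r\<in>set rs. length r = length v"
  shows "P (map (\<lambda>k. v ! k \<noteq> odd (\<Sum>i<length rs. c i * rs ! i ! k)) [0..<length v])"
  using assms
proof (induction rs arbitrary: c v)
  case Nil
  then show ?case by (simp add: map_nth)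
next
  case (Cons r rs)
  let ?v = "if even (c 0) then v else map2 (\<noteq>) v (map odd r)"
  have len: "length ?v = length v" using Cons.prems by simp
  have "all_comb P (map (map odd) rs) ?v" using Cons.prems by simp
  then have "P (map (\<lambda>k. ?v ! k \<noteq> odd (\<Sum>i<length rs. c (Suc i) * rs ! i ! k)) [0..<length v])"
    using Cons.IH[of ?v "\<lambda>i. c (Suc i)"] Cons.prems len by simp
  also have "map (\<lambda>k. ?v ! k \<noteq> odd (\<Sum>i<length rs. c (Suc i) * rs ! i ! k)) [0..<length v]
    = map (\<lambda>k. v ! k \<noteq> odd (\<Sum>i<length (r # rs). c i * (r # rs) ! i ! k)) [0..<length v]"
    using Cons.prems
    by (intro map_cong refl) (auto simp: sum.lessThan_Suc_shift simp del: sum.lessThan_Suc)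
  finally show ?case .
qed

text \<open>The selection ruled out by \<open>no_dep\<close> is the set of positions with odd
  coefficient; even coefficients vanish modulo 2.\<close>

lemma no_depD:
  assumes "no_dep d v (map (map odd) cs)" "\<forall>r\<in>set cs. length r = length v"
    and "{i. i < length cs \<and> odd (c i)} \<noteq> {}" "card {i. i < length cs \<and> odd (c i)} \<le> d"
  shows "\<exists>k<length v. v ! k \<noteq> odd (\<Sum>i<length cs. c i * cs ! i ! k)"
  using assms
proof (induction cs arbitrary: c d v)
  case Nil
  then show ?case by simp
next
  case (Cons r cs)
  let ?T = "{i. i < length cs \<and> odd (c (Suc i))}"
  have set_eq: "{i. i < length (r # cs) \<and> odd (c i)}
      = (if odd (c 0) then {0} else {}) \<union> Suc ` ?T" (is "?S = _")
    by (auto simp: less_Suc_eq_0_disj)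
  have card_eq: "card ?S = (if odd (c 0) then 1 else 0) + card ?T"
    unfolding set_eq by (subst card_Un_disjoint) (auto simp: card_image)
  have "card ?S > 0" using Cons.prems(3) by (subst card_gt_0_iff) auto
  then obtain e where d: "d = Suc e" using Cons.prems(4) by (metis Suc_pred less_le_trans)
  have sum_eq: "(\<Sum>i<length (r # cs). c i * (r # cs) ! i ! k)
      = c 0 * r ! k + (\<Sum>i<length cs. c (Suc i) * cs ! i ! k)" for k
    by (simp add: sum.lessThan_Suc_shift del: sum.lessThan_Suc)
  have len: "length r = length v" "\<forall>r\<in>set cs. length r = length v" using Cons.prems by auto
  show ?case
  proof (cases "even (c 0)")
    case True
    then have "?T \<noteq> {}" "card ?T \<le> d" using Cons.prems set_eq card_eq by auto
    moreover have "no_dep d v (map (map odd) cs)" using Cons.prems d by simp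
    ultimately have "\<exists>k<length v. v ! k \<noteq> odd (\<Sum>i<length cs. c (Suc i) * cs ! i ! k)"
      using Cons.IH[of d v "\<lambda>i. c (Suc i)"] len by blast
    then show ?thesis unfolding sum_eq using True by simp
  next
    case False
    show ?thesis
    proof (cases "?T = {}")
      \<comment> \<open>Here \<open>r\<close> is the only vector with an odd coefficient, so the
        test \<open>c \<noteq> v\<close> of the recursion applies directly.\<close>
      case True
      then have "even (\<Sum>i<length cs. c (Suc i) * cs ! i ! k)" for k
        by (auto intro!: dvd_sum)
      moreover have "map odd r \<noteq> v" using Cons.prems d by simp
      then obtain k where "k < length v" "v ! k \<noteq> odd (r ! k)"
        using len by (auto simp: list_eq_iff_nth_eq)
      ultimately show ?thesis
        unfolding sum_eq using False by (intro exI[of _ k]) simp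
    next
      case nonempty: False
      have "card ?T \<le> e" using Cons.prems card_eq d False by simp
      moreover have "no_dep e (map2 (\<noteq>) v (map odd r)) (map (map odd) cs)"
        using Cons.prems d by simp
      ultimately have "\<exists>k<length v. map2 (\<noteq>) v (map odd r) ! k
          \<noteq> odd (\<Sum>i<length cs. c (Suc i) * cs ! i ! k)"
        using Cons.IH[of e "map2 (\<noteq>) v (map odd r)" "\<lambda>i. c (Suc i)"] len nonempty by simp
      then obtain k where "k < length v" "map2 (\<noteq>) v (map odd r) ! k
          \<noteq> odd (\<Sum>i<length cs. c (Suc i) * cs ! i ! k)" by blast
      then show ?thesis
        unfolding sum_eq using False len by (intro exI[of _ k]) auto
    qed
  qed
qed

section \<open>The lattice\<close>

text \<open>The rows are twice the basis vectors.  The first ten generate \<open>C\<close> modulo 2 (the code was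
  found by computer search, the signs make inner products divisible by 4), the others are
  \<open>2 h\<close> with \<open>h\<close> modulo 2 in the dual of \<open>C\<close>, and \<open>4 e\<close> with \<open>e\<close> a unit vector.
  The matrix is triangular; \<open>dual_rows\<close> is 4 times its inverse transpose.\<close>

definition basis_rows :: "int list list" where
  "basis_rows = [
   [1,0,0,0,0,0,0,0,0,0,1,0,1,1,1,0,0,0,1,0,0,0,0,0,1,0,1,1,0,1,0,1,1,0,0,0,0,0,1,1,1,0,1],
   [0,1,0,0,0,0,0,0,0,0,1,1,0,1,1,1,1,1,0,0,0,1,1,0,0,0,1,0,1,0,0,0,1,1,1,0,1,0,0,1,1,1,1],
   [0,0,1,0,0,0,0,0,0,0,1,1,1,1,0,1,1,1,1,1,0,1,0,1,0,0,0,0,1,0,0,1,-1,0,0,0,0,0,0,0,0,1,0],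
   [0,0,0,1,0,0,0,0,0,0,1,1,1,0,0,1,0,0,0,1,0,0,1,1,1,1,1,1,1,1,0,0,-1,1,-1,1,0,1,0,-1,0,0,0],
   [0,0,0,0,1,0,0,0,0,0,1,0,0,0,1,0,1,0,1,0,0,1,1,1,0,1,0,1,0,1,1,0,1,0,1,0,0,0,1,0,1,0,0],
   [0,0,0,0,0,1,0,0,0,0,0,0,1,0,0,1,1,1,0,1,0,0,0,-1,1,1,1,0,0,0,0,0,0,1,1,-1,0,0,-1,0,-1,0,-1],
   [0,0,0,0,0,0,1,0,0,0,0,1,1,0,1,0,0,1,0,1,1,1,0,-1,1,0,0,1,0,0,1,0,0,0,0,0,1,-1,1,-1,0,0,0],
   [0,0,0,0,0,0,0,1,0,0,0,0,1,1,1,0,1,1,0,1,1,0,0,0,1,0,0,1,0,1,1,1,1,-1,1,0,0,1,0,-1,1,-1,0],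
   [0,0,0,0,0,0,0,0,1,0,1,0,1,1,0,0,1,0,1,1,0,1,1,0,0,0,1,0,1,1,1,0,0,0,1,0,-1,-1,1,1,-1,0,1],
   [0,0,0,0,0,0,0,0,0,1,0,0,0,0,0,1,1,1,0,1,1,0,1,0,-1,0,0,-1,1,0,0,0,0,0,0,1,1,1,-1,0,0,-1,-1],
   [0,0,0,0,0,0,0,0,0,0,2,0,0,0,0,0,0,0,0,0,0,0,0,0,0,0,0,0,0,0,0,0,0,2,2,0,2,0,0,2,0,2,0],
   [0,0,0,0,0,0,0,0,0,0,0,2,0,0,0,0,0,0,0,0,0,0,0,0,0,0,0,0,0,0,0,0,0,2,0,0,2,2,0,2,0,2,2],
   [0,0,0,0,0,0,0,0,0,0,0,0,2,0,0,0,0,0,0,0,0,0,0,0,0,0,0,0,0,0,0,0,0,2,2,0,0,2,0,0,2,2,0],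
   [0,0,0,0,0,0,0,0,0,0,0,0,0,2,0,0,0,0,0,0,0,0,0,0,0,0,0,0,0,0,0,0,0,0,2,2,0,2,0,2,2,2,2],
   [0,0,0,0,0,0,0,0,0,0,0,0,0,0,2,0,0,0,0,0,0,0,0,0,0,0,0,0,0,0,0,0,0,2,0,2,0,2,2,2,0,0,2],
   [0,0,0,0,0,0,0,0,0,0,0,0,0,0,0,2,0,0,0,0,0,0,0,0,0,0,0,0,0,0,0,0,0,0,2,2,2,0,0,2,2,2,0],
   [0,0,0,0,0,0,0,0,0,0,0,0,0,0,0,0,2,0,0,0,0,0,0,0,0,0,0,0,0,0,0,0,0,0,2,0,2,2,0,0,0,2,0],
   [0,0,0,0,0,0,0,0,0,0,0,0,0,0,0,0,0,2,0,0,0,0,0,0,0,0,0,0,0,0,0,0,0,0,0,2,2,2,2,0,2,2,0],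
   [0,0,0,0,0,0,0,0,0,0,0,0,0,0,0,0,0,0,2,0,0,0,0,0,0,0,0,0,0,0,0,0,0,0,2,0,0,2,2,0,2,2,2],
   [0,0,0,0,0,0,0,0,0,0,0,0,0,0,0,0,0,0,0,2,0,0,0,0,0,0,0,0,0,0,0,0,0,0,0,2,2,0,0,0,0,2,0],
   [0,0,0,0,0,0,0,0,0,0,0,0,0,0,0,0,0,0,0,0,2,0,0,0,0,0,0,0,0,0,0,0,0,2,2,2,2,0,2,2,0,0,0],
   [0,0,0,0,0,0,0,0,0,0,0,0,0,0,0,0,0,0,0,0,0,2,0,0,0,0,0,0,0,0,0,0,0,0,0,2,2,0,2,2,0,2,0],
   [0,0,0,0,0,0,0,0,0,0,0,0,0,0,0,0,0,0,0,0,0,0,2,0,0,0,0,0,0,0,0,0,0,2,0,0,0,2,0,2,2,0,0],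
   [0,0,0,0,0,0,0,0,0,0,0,0,0,0,0,0,0,0,0,0,0,0,0,2,0,0,0,0,0,0,0,0,0,2,0,2,0,0,0,2,2,2,0],
   [0,0,0,0,0,0,0,0,0,0,0,0,0,0,0,0,0,0,0,0,0,0,0,0,2,0,0,0,0,0,0,0,0,0,0,2,0,2,2,2,2,0,0],
   [0,0,0,0,0,0,0,0,0,0,0,0,0,0,0,0,0,0,0,0,0,0,0,0,0,2,0,0,0,0,0,0,0,2,0,2,0,0,2,2,0,0,0],
   [0,0,0,0,0,0,0,0,0,0,0,0,0,0,0,0,0,0,0,0,0,0,0,0,0,0,2,0,0,0,0,0,0,2,0,2,2,2,0,0,0,0,2],
   [0,0,0,0,0,0,0,0,0,0,0,0,0,0,0,0,0,0,0,0,0,0,0,0,0,0,0,2,0,0,0,0,0,2,2,2,0,0,2,0,2,0,2],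
   [0,0,0,0,0,0,0,0,0,0,0,0,0,0,0,0,0,0,0,0,0,0,0,0,0,0,0,0,2,0,0,0,0,0,2,2,2,2,0,0,2,2,2],
   [0,0,0,0,0,0,0,0,0,0,0,0,0,0,0,0,0,0,0,0,0,0,0,0,0,0,0,0,0,2,0,0,0,0,0,0,0,0,2,2,0,0,2],
   [0,0,0,0,0,0,0,0,0,0,0,0,0,0,0,0,0,0,0,0,0,0,0,0,0,0,0,0,0,0,2,0,0,2,2,2,0,0,0,2,0,0,2],
   [0,0,0,0,0,0,0,0,0,0,0,0,0,0,0,0,0,0,0,0,0,0,0,0,0,0,0,0,0,0,0,2,0,0,0,0,0,2,0,2,0,2,0],
   [0,0,0,0,0,0,0,0,0,0,0,0,0,0,0,0,0,0,0,0,0,0,0,0,0,0,0,0,0,0,0,0,2,2,2,0,0,0,2,2,2,2,0],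
   [0,0,0,0,0,0,0,0,0,0,0,0,0,0,0,0,0,0,0,0,0,0,0,0,0,0,0,0,0,0,0,0,0,4,0,0,0,0,0,0,0,0,0],
   [0,0,0,0,0,0,0,0,0,0,0,0,0,0,0,0,0,0,0,0,0,0,0,0,0,0,0,0,0,0,0,0,0,0,4,0,0,0,0,0,0,0,0],
   [0,0,0,0,0,0,0,0,0,0,0,0,0,0,0,0,0,0,0,0,0,0,0,0,0,0,0,0,0,0,0,0,0,0,0,4,0,0,0,0,0,0,0],
   [0,0,0,0,0,0,0,0,0,0,0,0,0,0,0,0,0,0,0,0,0,0,0,0,0,0,0,0,0,0,0,0,0,0,0,0,4,0,0,0,0,0,0],
   [0,0,0,0,0,0,0,0,0,0,0,0,0,0,0,0,0,0,0,0,0,0,0,0,0,0,0,0,0,0,0,0,0,0,0,0,0,4,0,0,0,0,0],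
   [0,0,0,0,0,0,0,0,0,0,0,0,0,0,0,0,0,0,0,0,0,0,0,0,0,0,0,0,0,0,0,0,0,0,0,0,0,0,4,0,0,0,0],
   [0,0,0,0,0,0,0,0,0,0,0,0,0,0,0,0,0,0,0,0,0,0,0,0,0,0,0,0,0,0,0,0,0,0,0,0,0,0,0,4,0,0,0],
   [0,0,0,0,0,0,0,0,0,0,0,0,0,0,0,0,0,0,0,0,0,0,0,0,0,0,0,0,0,0,0,0,0,0,0,0,0,0,0,0,4,0,0],
   [0,0,0,0,0,0,0,0,0,0,0,0,0,0,0,0,0,0,0,0,0,0,0,0,0,0,0,0,0,0,0,0,0,0,0,0,0,0,0,0,0,4,0],
   [0,0,0,0,0,0,0,0,0,0,0,0,0,0,0,0,0,0,0,0,0,0,0,0,0,0,0,0,0,0,0,0,0,0,0,0,0,0,0,0,0,0,4]]"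

definition dual_rows :: "int list list" where
  "dual_rows = [
   [4,0,0,0,0,0,0,0,0,0,0,0,0,0,0,0,0,0,0,0,0,0,0,0,0,0,0,0,0,0,0,0,0,0,0,0,0,0,0,0,0,0,0],
   [0,4,0,0,0,0,0,0,0,0,0,0,0,0,0,0,0,0,0,0,0,0,0,0,0,0,0,0,0,0,0,0,0,0,0,0,0,0,0,0,0,0,0],
   [0,0,4,0,0,0,0,0,0,0,0,0,0,0,0,0,0,0,0,0,0,0,0,0,0,0,0,0,0,0,0,0,0,0,0,0,0,0,0,0,0,0,0],
   [0,0,0,4,0,0,0,0,0,0,0,0,0,0,0,0,0,0,0,0,0,0,0,0,0,0,0,0,0,0,0,0,0,0,0,0,0,0,0,0,0,0,0],
   [0,0,0,0,4,0,0,0,0,0,0,0,0,0,0,0,0,0,0,0,0,0,0,0,0,0,0,0,0,0,0,0,0,0,0,0,0,0,0,0,0,0,0],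
   [0,0,0,0,0,4,0,0,0,0,0,0,0,0,0,0,0,0,0,0,0,0,0,0,0,0,0,0,0,0,0,0,0,0,0,0,0,0,0,0,0,0,0],
   [0,0,0,0,0,0,4,0,0,0,0,0,0,0,0,0,0,0,0,0,0,0,0,0,0,0,0,0,0,0,0,0,0,0,0,0,0,0,0,0,0,0,0],
   [0,0,0,0,0,0,0,4,0,0,0,0,0,0,0,0,0,0,0,0,0,0,0,0,0,0,0,0,0,0,0,0,0,0,0,0,0,0,0,0,0,0,0],
   [0,0,0,0,0,0,0,0,4,0,0,0,0,0,0,0,0,0,0,0,0,0,0,0,0,0,0,0,0,0,0,0,0,0,0,0,0,0,0,0,0,0,0],
   [0,0,0,0,0,0,0,0,0,4,0,0,0,0,0,0,0,0,0,0,0,0,0,0,0,0,0,0,0,0,0,0,0,0,0,0,0,0,0,0,0,0,0],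
   [-2,-2,-2,-2,-2,0,0,0,-2,0,2,0,0,0,0,0,0,0,0,0,0,0,0,0,0,0,0,0,0,0,0,0,0,0,0,0,0,0,0,0,0,0,0],
   [0,-2,-2,-2,0,0,-2,0,0,0,0,2,0,0,0,0,0,0,0,0,0,0,0,0,0,0,0,0,0,0,0,0,0,0,0,0,0,0,0,0,0,0,0],
   [-2,0,-2,-2,0,-2,-2,-2,-2,0,0,0,2,0,0,0,0,0,0,0,0,0,0,0,0,0,0,0,0,0,0,0,0,0,0,0,0,0,0,0,0,0,0],
   [-2,-2,-2,0,0,0,0,-2,-2,0,0,0,0,2,0,0,0,0,0,0,0,0,0,0,0,0,0,0,0,0,0,0,0,0,0,0,0,0,0,0,0,0,0],
   [-2,-2,0,0,-2,0,-2,-2,0,0,0,0,0,0,2,0,0,0,0,0,0,0,0,0,0,0,0,0,0,0,0,0,0,0,0,0,0,0,0,0,0,0,0],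
   [0,-2,-2,-2,0,-2,0,0,0,-2,0,0,0,0,0,2,0,0,0,0,0,0,0,0,0,0,0,0,0,0,0,0,0,0,0,0,0,0,0,0,0,0,0],
   [0,-2,-2,0,-2,-2,0,-2,-2,-2,0,0,0,0,0,0,2,0,0,0,0,0,0,0,0,0,0,0,0,0,0,0,0,0,0,0,0,0,0,0,0,0,0],
   [0,-2,-2,0,0,-2,-2,-2,0,-2,0,0,0,0,0,0,0,2,0,0,0,0,0,0,0,0,0,0,0,0,0,0,0,0,0,0,0,0,0,0,0,0,0],
   [-2,0,-2,0,-2,0,0,0,-2,0,0,0,0,0,0,0,0,0,2,0,0,0,0,0,0,0,0,0,0,0,0,0,0,0,0,0,0,0,0,0,0,0,0],
   [0,0,-2,-2,0,-2,-2,-2,-2,-2,0,0,0,0,0,0,0,0,0,2,0,0,0,0,0,0,0,0,0,0,0,0,0,0,0,0,0,0,0,0,0,0,0],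
   [0,0,0,0,0,0,-2,-2,0,-2,0,0,0,0,0,0,0,0,0,0,2,0,0,0,0,0,0,0,0,0,0,0,0,0,0,0,0,0,0,0,0,0,0],
   [0,-2,-2,0,-2,0,-2,0,-2,0,0,0,0,0,0,0,0,0,0,0,0,2,0,0,0,0,0,0,0,0,0,0,0,0,0,0,0,0,0,0,0,0,0],
   [0,-2,0,-2,-2,0,0,0,-2,-2,0,0,0,0,0,0,0,0,0,0,0,0,2,0,0,0,0,0,0,0,0,0,0,0,0,0,0,0,0,0,0,0,0],
   [0,0,-2,-2,-2,2,2,0,0,0,0,0,0,0,0,0,0,0,0,0,0,0,0,2,0,0,0,0,0,0,0,0,0,0,0,0,0,0,0,0,0,0,0],
   [-2,0,0,-2,0,-2,-2,-2,0,2,0,0,0,0,0,0,0,0,0,0,0,0,0,0,2,0,0,0,0,0,0,0,0,0,0,0,0,0,0,0,0,0,0],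
   [0,0,0,-2,-2,-2,0,0,0,0,0,0,0,0,0,0,0,0,0,0,0,0,0,0,0,2,0,0,0,0,0,0,0,0,0,0,0,0,0,0,0,0,0],
   [-2,-2,0,-2,0,-2,0,0,-2,0,0,0,0,0,0,0,0,0,0,0,0,0,0,0,0,0,2,0,0,0,0,0,0,0,0,0,0,0,0,0,0,0,0],
   [-2,0,0,-2,-2,0,-2,-2,0,2,0,0,0,0,0,0,0,0,0,0,0,0,0,0,0,0,0,2,0,0,0,0,0,0,0,0,0,0,0,0,0,0,0],
   [0,-2,-2,-2,0,0,0,0,-2,-2,0,0,0,0,0,0,0,0,0,0,0,0,0,0,0,0,0,0,2,0,0,0,0,0,0,0,0,0,0,0,0,0,0],
   [-2,0,0,-2,-2,0,0,-2,-2,0,0,0,0,0,0,0,0,0,0,0,0,0,0,0,0,0,0,0,0,2,0,0,0,0,0,0,0,0,0,0,0,0,0],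
   [0,0,0,0,-2,0,-2,-2,-2,0,0,0,0,0,0,0,0,0,0,0,0,0,0,0,0,0,0,0,0,0,2,0,0,0,0,0,0,0,0,0,0,0,0],
   [-2,0,-2,0,0,0,0,-2,0,0,0,0,0,0,0,0,0,0,0,0,0,0,0,0,0,0,0,0,0,0,0,2,0,0,0,0,0,0,0,0,0,0,0],
   [-2,-2,2,2,-2,0,0,-2,0,0,0,0,0,0,0,0,0,0,0,0,0,0,0,0,0,0,0,0,0,0,0,0,2,0,0,0,0,0,0,0,0,0,0],
   [6,5,3,6,8,1,5,7,5,1,-1,-1,-1,0,-1,0,0,0,0,0,-1,0,-1,-1,0,-1,-1,-1,0,0,-1,0,-1,1,0,0,0,0,0,0,0,0,0],
   [6,5,6,5,5,2,4,6,6,3,-1,0,-1,-1,0,-1,-1,0,-1,0,-1,0,0,0,0,0,0,-1,-1,0,-1,0,-1,0,1,0,0,0,0,0,0,0,0],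
   [5,7,7,7,6,6,7,8,6,2,0,0,0,-1,-1,-1,0,-1,0,-1,-1,-1,0,-1,-1,-1,-1,-1,-1,0,-1,0,0,0,0,1,0,0,0,0,0,0,0],
   [2,7,8,6,3,5,4,4,7,5,-1,-1,0,0,0,-1,-1,-1,0,-1,-1,-1,0,0,0,0,-1,0,-1,0,0,0,0,0,0,0,1,0,0,0,0,0,0],
   [7,8,8,5,4,5,6,6,8,2,0,-1,-1,-1,-1,0,-1,-1,-1,0,0,0,-1,0,-1,0,-1,0,-1,0,0,-1,0,0,0,0,0,1,0,0,0,0,0],
   [5,4,2,3,6,4,5,7,2,1,0,0,0,0,-1,0,0,-1,-1,0,-1,-1,0,0,-1,-1,0,-1,0,-1,0,0,-1,0,0,0,0,0,1,0,0,0,0],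
   [6,7,6,8,9,2,6,9,5,2,-1,-1,0,-1,-1,-1,0,0,0,0,-1,-1,-1,-1,-1,-1,0,0,0,-1,-1,-1,-1,0,0,0,0,0,0,1,0,0,0],
   [5,5,6,6,4,4,3,5,6,2,0,0,-1,-1,0,-1,0,-1,-1,0,0,0,-1,-1,-1,0,0,-1,-1,0,0,0,-1,0,0,0,0,0,0,0,1,0,0],
   [6,8,11,6,6,4,4,8,8,6,-1,-1,-1,-1,0,-1,-1,-1,-1,-1,0,-1,0,-1,0,0,0,0,-1,0,0,-1,-1,0,0,0,0,0,0,0,0,1,0],
   [5,4,4,5,5,2,4,5,5,1,0,-1,0,-1,-1,0,0,0,-1,0,0,0,0,0,0,0,-1,-1,-1,-1,-1,0,0,0,0,0,0,0,0,0,0,0,1]]"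

definition shadow_row :: "int list" where
  "shadow_row = [1,0,0,0,1,0,1,1,1,1,0,0,0,1,0,1,0,0,0,0,1,-1,1,0,1,-1,0,0,0,0,1,0,0,0,0,-1,0,0,0,-1,-1,-1,-1]"

section \<open>Finite checks on the matrices and the code, by evaluation\<close>

lemma basis_rows_length: "length basis_rows = 43" "list_all (\<lambda>r. length r = 43) basis_rows"
  by code_simp+

lemma dual_rows_length: "length dual_rows = 43" "list_all (\<lambda>r. length r = 43) dual_rows"
  by code_simp+

lemma basis_rows_gram:
  "list_all (\<lambda>a. list_all (\<lambda>b. dot a b mod 4 = 0) basis_rows) basis_rows"
  by code_simp

lemma dual_rows_gram:
  "list_all (\<lambda>a. list_all (\<lambda>b. dot a b mod 4 = 0) dual_rows) dual_rows"
  by code_simp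

text \<open>Lists are rows, so the columns are taken by transposing both matrices; the result is 4
  times the identity matrix.\<close>

lemma dual_rows_basis_rows:
  "map (\<lambda>a. map (dot a) (List.transpose basis_rows)) (List.transpose dual_rows) =
    map (\<lambda>k. map (\<lambda>l. if l = k then 4 else 0) [0..<43]) [0..<43]"
  by code_simp

lemma basis_rows_even: "list_all (list_all even) (drop 10 basis_rows)"
  by code_simp

lemma basis_rows_code_weights:
  "all_comb (\<lambda>v. length (filter id v) \<ge> 16 \<or> \<not> list_ex id v)
    (map (map odd) (take 10 basis_rows)) (replicate 43 False)"
  by code_simp

text \<open>A word of the dual code is a linear dependency among the columns of the generator
  matrix, so dual distance at least 4 means that no three or fewer columns sum to zero.\<close>

lemma basis_rows_code_dual_distance:
  "no_dep 3 (replicate 10 False) (map (map odd) (List.transpose (take 10 basis_rows)))"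
  by code_simp

lemma basis_rows_norm_4: "dot (last basis_rows) (last basis_rows) = 16"
  by code_simp

lemma shadow_row_length: "length shadow_row = 43"
  by code_simp

lemma shadow_row_norm: "dot shadow_row shadow_row = 19"
  by code_simp

text \<open>Halving the vectors divides products by 4, so divisibility by 8 becomes evenness of
  \<open>2 * (s \<bullet> b) - b \<bullet> b\<close>.\<close>

lemma shadow_row_characteristic:
  "list_all (\<lambda>a. (2 * dot shadow_row a - dot a a) mod 8 = 0) basis_rows"
  by code_simp

text \<open>Modulo 2 this coset consists of the complements of codewords; the bound 15 reflects the
  maximal weight 28 of the code.\<close>

lemma shadow_row_coset_weights:
  "all_comb (\<lambda>v. length (filter id v) \<ge> 15)
    (map (map odd) (take 10 basis_rows)) (map odd shadow_row)"
  by code_simp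

section \<open>The lattice and its unimodularity\<close>

definition basis_vec :: "nat \<Rightarrow> real ^ 43" where
  "basis_vec i = half_vec ((!) (basis_rows ! i))"

definition dual_vec :: "nat \<Rightarrow> real ^ 43" where
  "dual_vec i = half_vec ((!) (dual_rows ! i))"

definition shadow_vec :: "real ^ 43" where
  "shadow_vec = half_vec ((!) shadow_row)"

definition lattice43 :: "(real ^ 43) set" where
  "lattice43 = {\<Sum>i<43. of_int (c i) *\<^sub>R basis_vec i | c. True}"

abbreviation doubled_coords :: "(nat \<Rightarrow> int) \<Rightarrow> nat \<Rightarrow> int" where
  "doubled_coords c \<equiv> \<lambda>k. \<Sum>i<43. c i * basis_rows ! i ! k"

lemma length_basis_row: "i < 43 \<Longrightarrow> length (basis_rows ! i) = 43"
  using basis_rows_length by (simp add: list_all_length)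

lemma length_dual_row: "i < 43 \<Longrightarrow> length (dual_rows ! i) = 43"
  using dual_rows_length by (simp add: list_all_length)

lemma inner_half_vec_list:
  assumes "length xs = 43" "length ys = 43"
  shows "(half_vec ((!) xs) :: real ^ 43) \<bullet> half_vec ((!) ys) = of_int (dot xs ys) / 4"
  using assms by (simp add: inner_half_vec dot_eq_sum)

lemma of_int_div_4_Ints: "(of_int m / 4 :: real) \<in> \<int>" if "m mod 4 = 0" for m :: int
proof -
  have "m = 4 * (m div 4)" using that by presburger
  then have "(of_int m / 4 :: real) = of_int (m div 4)"
    by (metis nonzero_mult_div_cancel_left of_int_mult of_int_numeral zero_neq_numeral)
  then show ?thesis by (metis Ints_of_int)
qed

lemma inner_basis_vec: "basis_vec i \<bullet> basis_vec j \<in> \<int>" if "i < 43" "j < 43"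
  using that basis_rows_gram basis_rows_length
  by (auto simp: basis_vec_def inner_half_vec_list length_basis_row list_all_length
      intro!: of_int_div_4_Ints)

lemma inner_dual_vec: "dual_vec i \<bullet> dual_vec j \<in> \<int>" if "i < 43" "j < 43"
  using that dual_rows_gram dual_rows_length
  by (auto simp: dual_vec_def inner_half_vec_list length_dual_row list_all_length
      intro!: of_int_div_4_Ints)

lemma sum_dual_basis: "(\<Sum>j<43. (x \<bullet> dual_vec j) *\<^sub>R basis_vec j) = x"
  unfolding dual_vec_def basis_vec_def
proof (rule sum_dual_half_vec)
  fix k l :: nat
  assume kl: "k < CARD(43)" "l < CARD(43)"
  have tb: "List.transpose basis_rows = map (\<lambda>l. map (\<lambda>j. basis_rows ! j ! l) [0..<43]) [0..<43]"
    using transpose_rectangle[of basis_rows 43] basis_rows_length length_basis_row by fastforce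
  have td: "List.transpose dual_rows = map (\<lambda>k. map (\<lambda>j. dual_rows ! j ! k) [0..<43]) [0..<43]"
    using transpose_rectangle[of dual_rows 43] dual_rows_length length_dual_row by fastforce
  have "dot (List.transpose dual_rows ! k) (List.transpose basis_rows ! l)
      = map (\<lambda>a. map (dot a) (List.transpose basis_rows)) (List.transpose dual_rows) ! k ! l"
    using kl by (simp add: tb td del: upt_Suc upt.simps)
  also have "\<dots> = (if l = k then 4 else 0)"
    unfolding dual_rows_basis_rows using kl by (simp del: upt_Suc upt.simps)
  finally show "(\<Sum>j<43. dual_rows ! j ! k * basis_rows ! j ! l) = (if l = k then 4 else 0)"
    using kl by (simp add: tb td dot_eq_sum del: upt_Suc upt.simps)
qed

lemma unimodular_lattice43: "unimodular lattice43"
proof -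
  have "unimodular {\<Sum>i<DIM(real ^ 43). of_int (c i) *\<^sub>R basis_vec i | c. True}"
    by (rule unimodularI[where w = dual_vec])
      (use inner_basis_vec inner_dual_vec sum_dual_basis in simp_all)
  then show ?thesis by (simp add: lattice43_def)
qed

lemma lattice43_cases:
  assumes "x \<in> lattice43"
  obtains c where "x = half_vec (doubled_coords c)" "x = (\<Sum>i<43. of_int (c i) *\<^sub>R basis_vec i)"
  using assms by (auto simp: lattice43_def basis_vec_def sum_half_vec)

lemma basis_vec_in_lattice43: "basis_vec i \<in> lattice43" if "i < 43"
proof -
  have "(\<Sum>j<43. of_int (if j = i then 1 else 0) *\<^sub>R basis_vec j) = basis_vec i"
    using that by (simp add: if_distrib[of "\<lambda>r. r *\<^sub>R _"] if_distrib[of of_int] cong: if_cong)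
  then show ?thesis
    unfolding lattice43_def by (intro CollectI exI[of _ "\<lambda>j. if j = i then 1 else 0"]) simp
qed

text \<open>All rows after the first ten have even entries, so only the generators of the residue
  code affect parity.\<close>

lemma odd_doubled_coords:
  assumes "k < 43"
  shows "odd (doubled_coords c k) \<longleftrightarrow> odd (\<Sum>i<10. c i * take 10 basis_rows ! i ! k)"
proof -
  have "even (basis_rows ! i ! k)" if "i \<in> {10..<43}" for i
  proof -
    have "drop 10 basis_rows ! (i - 10) = basis_rows ! i" "i - 10 < length (drop 10 basis_rows)"
      using that basis_rows_length by auto
    then have "list_all even (basis_rows ! i)"
      using basis_rows_even by (metis list_all_length)
    then show ?thesis using assms that length_basis_row[of i] by (simp add: list_all_length)
  qed
  then have "even (\<Sum>i=10..<43. c i * basis_rows ! i ! k)" by (intro dvd_sum) auto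
  moreover have "doubled_coords c k = (\<Sum>i<10. c i * basis_rows ! i ! k) + (\<Sum>i=10..<43. c i * basis_rows ! i ! k)"
    using sum.atLeastLessThan_concat[of 0 10 43 "\<lambda>i. c i * basis_rows ! i ! k"]
    by (simp add: atLeast0LessThan)
  ultimately show ?thesis by simp
qed

text \<open>The parity pattern of twice a lattice vector is a codeword of the binary residue code.\<close>

lemma all_comb_doubled_coords:
  assumes "all_comb P (map (map odd) (take 10 basis_rows)) v" "length v = 43"
  shows "P (map (\<lambda>k. v ! k \<noteq> odd (doubled_coords c k)) [0..<43])"
proof -
  have "length r = length v" if "r \<in> set (take 10 basis_rows)" for r
    using in_set_takeD[OF that] basis_rows_length assms(2) by (auto simp: list_all_iff)
  then have "P (map (\<lambda>k. v ! k \<noteq> odd (\<Sum>i<length (take 10 basis_rows).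
      c i * take 10 basis_rows ! i ! k)) [0..<length v])"
    using all_combD[OF assms(1)] by blast
  moreover have "length (take 10 basis_rows) = 10" using basis_rows_length by simp
  moreover have "map (\<lambda>k. v ! k \<noteq> odd (\<Sum>i<10. c i * take 10 basis_rows ! i ! k)) [0..<43]
      = map (\<lambda>k. v ! k \<noteq> odd (doubled_coords c k)) [0..<43]"
    by (rule map_cong[OF refl]) (simp only: set_upt atLeastLessThan_iff odd_doubled_coords)
  ultimately show ?thesis using assms(2) by metis
qed

lemma length_filter_id_map: "length (filter id (map f [0..<n])) = card {k. k < n \<and> f k}"
proof -
  have "length (filter id (map f [0..<n])) = card (set (filter f [0..<n]))"
    by (simp add: filter_map o_def flip: distinct_card)
  also have "set (filter f [0..<n]) = {k. k < n \<and> f k}" by auto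
  finally show ?thesis .
qed

section \<open>The minimum norm of the lattice\<close>

lemma lattice43_norm_ge:
  assumes "x \<in> lattice43" "x \<noteq> 0"
  shows "4 \<le> x \<bullet> x"
proof -
  obtain c where x: "x = half_vec (doubled_coords c)" using assms(1) lattice43_cases by blast
  define t where "t = doubled_coords c"
  have xt: "x = half_vec t" using x by (simp add: t_def)
  have norm: "x \<bullet> x = of_int (\<Sum>k<43. t k * t k) / 4"
    unfolding xt by (simp add: inner_half_vec)
  show ?thesis
  proof (cases "\<exists>k<43. odd (t k)")
    case True
    \<comment> \<open>The comparison with the zero word brings the parity pattern into the form
      produced by \<open>all_comb\<close>.\<close>
    let ?v = "map (\<lambda>k. replicate 43 False ! k \<noteq> odd (t k)) [0..<43]"
    have v: "?v = map (\<lambda>k. odd (t k)) [0..<43]" by (intro map_cong refl) simp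
    have "length (filter id ?v) \<ge> 16 \<or> \<not> list_ex id ?v"
      unfolding t_def by (rule all_comb_doubled_coords[OF basis_rows_code_weights]) simp
    moreover have "list_ex id ?v"
      using True unfolding v list_ex_iff by (auto simp del: upt.simps upt_Suc)
    ultimately have "card {k. k < 43 \<and> odd (t k)} \<ge> 16"
      unfolding v length_filter_id_map by simp
    then have "(\<Sum>k<43. t k * t k) \<ge> 16" using card_odd_le_sum_squares[of 43 t] by linarith
    then show ?thesis unfolding norm by linarith
  next
    case False
    define y where "y k = t k div 2" for k
    have ty: "t k = 2 * y k" if "k < 43" for k using False that by (auto simp: y_def)
    have norm_y: "(\<Sum>k<43. t k * t k) = 4 * (\<Sum>k<43. y k * y k)"
      unfolding sum_distrib_left by (intro sum.cong) (auto simp: ty)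
    let ?O = "{k. k < 43 \<and> odd (y k)}"
    show ?thesis
    proof (rule ccontr)
      assume "\<not> ?thesis"
      then have "real_of_int (\<Sum>k<43. y k * y k) < of_int 4"
        unfolding norm norm_y by (simp del: of_int_sum of_int_mult add: of_int_mult)
      then have small: "(\<Sum>k<43. y k * y k) < 4" by (simp only: of_int_less_iff)
      \<comment> \<open>If all \<open>y k\<close> were even, a nonzero one would contribute at least
        4 to the sum of squares.\<close>
      have "?O \<noteq> {}"
      proof
        assume "?O = {}"
        then have ev: "even (y k)" if "k < 43" for k using that by auto
        obtain k where k: "k < 43" "y k \<noteq> 0"
          using half_vec_eq_0[where t = t and 'n = 43] assms(2) xt ty by force
        then obtain m where "y k = 2 * m" "m \<noteq> 0" using ev by fastforce
        then have "y k * y k \<ge> 4"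
          using zero_less_mult_iff[of m m] by (auto simp: not_less) (smt (verit) mult_eq_0_iff zero_le_square)
        moreover have "y k * y k \<le> (\<Sum>k<43. y k * y k)"
          using k by (intro member_le_sum) auto
        ultimately show False using small by linarith
      qed
      moreover have "card ?O \<le> 3" using card_odd_le_sum_squares[of 43 y] small by linarith
      moreover have cols: "List.transpose (take 10 basis_rows)
          = map (\<lambda>k. map (\<lambda>i. basis_rows ! i ! k) [0..<10]) [0..<43]"
      proof -
        have "List.transpose (take 10 basis_rows)
            = map (\<lambda>k. map (\<lambda>i. take 10 basis_rows ! i ! k) [0..<length (take 10 basis_rows)]) [0..<43]"
          using basis_rows_length length_basis_row by (intro transpose_rectangle) auto
        also have "\<dots> = map (\<lambda>k. map (\<lambda>i. basis_rows ! i ! k) [0..<10]) [0..<43]"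
          using basis_rows_length by (intro map_cong refl) auto
        finally show ?thesis .
      qed
      moreover have "length (List.transpose (take 10 basis_rows)) = 43" unfolding cols by simp
      moreover have "\<forall>r\<in>set (List.transpose (take 10 basis_rows)). length r = length (replicate 10 False)"
        unfolding cols by (auto simp del: upt_Suc upt.simps)
      \<comment> \<open>At most three odd entries are too few for \<open>y\<close> modulo 2 to be a
        dual word, so some generator has an odd product with \<open>y\<close>. Then
        \<open>x \<bullet> basis_vec i\<close> is half an odd integer, against integrality.\<close>
      ultimately obtain i where i: "i < 10"
        "odd (\<Sum>k<43. y k * List.transpose (take 10 basis_rows) ! k ! i)"
        using no_depD[OF basis_rows_code_dual_distance, of y] by auto
      have "(\<Sum>k<43. y k * List.transpose (take 10 basis_rows) ! k ! i)
          = (\<Sum>k<43. y k * basis_rows ! i ! k)"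
        using i(1) unfolding cols by (intro sum.cong refl) (simp del: upt_Suc upt.simps)
      then have odd_i: "odd (\<Sum>k<43. y k * basis_rows ! i ! k)" using i by simp
      have "x \<bullet> basis_vec i = of_int (\<Sum>k<43. t k * basis_rows ! i ! k) / 4"
        unfolding xt basis_vec_def by (simp add: inner_half_vec)
      also have "(\<Sum>k<43. t k * basis_rows ! i ! k) = 2 * (\<Sum>k<43. y k * basis_rows ! i ! k)"
        unfolding sum_distrib_left by (intro sum.cong) (auto simp: ty)
      finally have "2 * (x \<bullet> basis_vec i) = of_int (\<Sum>k<43. y k * basis_rows ! i ! k)" by simp
      moreover obtain m :: int where "x \<bullet> basis_vec i = of_int m"
        using unimodular_inner_Ints[OF unimodular_lattice43 assms(1) basis_vec_in_lattice43[of i]] i(1)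
        by (auto elim: Ints_cases)
      ultimately have "real_of_int (2 * m) = of_int (\<Sum>k<43. y k * basis_rows ! i ! k)" by simp
      then have "2 * m = (\<Sum>k<43. y k * basis_rows ! i ! k)" by (simp only: of_int_eq_iff)
      then show False using odd_i by presburger
    qed
  qed
qed

lemma min_norm_lattice43: "min_norm lattice43 = 4"
proof (rule min_norm_eqI)
  \<comment> \<open>The last row is 4 times a unit vector; halved, it has norm 4 and attains the
    bound.\<close>
  show "basis_vec 42 \<in> lattice43" by (simp add: basis_vec_in_lattice43)
  have "last basis_rows = basis_rows ! 42"
    using basis_rows_length by (subst last_conv_nth) auto
  then show norm: "basis_vec 42 \<bullet> basis_vec 42 = 4"
    using basis_rows_norm_4 by (simp add: basis_vec_def inner_half_vec_list length_basis_row)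
  show "basis_vec 42 \<noteq> 0" using norm by auto
qed (rule lattice43_norm_ge)

section \<open>The shadow and its minimum norm\<close>

lemma shadow_vec_norm: "shadow_vec \<bullet> shadow_vec = 19 / 4"
  by (simp add: shadow_vec_def inner_half_vec_list shadow_row_length shadow_row_norm)

lemma shadow_vec_characteristic:
  assumes "x \<in> lattice43"
  shows "\<exists>k::int. 2 * (shadow_vec \<bullet> x) - x \<bullet> x = 2 * of_int k"
proof -
  obtain c where "x = (\<Sum>i<43. of_int (c i) *\<^sub>R basis_vec i)"
    using assms lattice43_cases by blast
  from inner_basis_vec _ this show ?thesis
  proof (rule characteristic_sum)
    fix i :: nat assume i: "i < 43"
    let ?r = "basis_rows ! i"
    have "(2 * dot shadow_row ?r - dot ?r ?r) mod 8 = 0"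
      using shadow_row_characteristic basis_rows_length i by (simp add: list_all_length)
    then obtain k where k: "2 * dot shadow_row ?r - dot ?r ?r = 8 * k" by fastforce
    have "2 * (shadow_vec \<bullet> basis_vec i) - basis_vec i \<bullet> basis_vec i
        = of_int (2 * dot shadow_row ?r - dot ?r ?r) / 4"
      using i by (simp add: shadow_vec_def basis_vec_def inner_half_vec_list shadow_row_length
          length_basis_row diff_divide_distrib)
    then show "\<exists>k::int. 2 * (shadow_vec \<bullet> basis_vec i) - basis_vec i \<bullet> basis_vec i = 2 * of_int k"
      unfolding k by (intro exI[of _ k]) simp
  qed auto
qed

lemma shadow_lattice43: "shadow lattice43 = (\<lambda>x. shadow_vec + x) ` lattice43"
proof (rule shadow_eq_translate[OF unimodular_lattice43 _ shadow_vec_characteristic])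
  show "shadow_vec \<notin> lattice43"
  proof
    assume "shadow_vec \<in> lattice43"
    \<comment> \<open>Lattice vectors have integral norm, but 19/4 is not an integer.\<close>
    then have "shadow_vec \<bullet> shadow_vec \<in> \<int>" using unimodular_inner_Ints unimodular_lattice43 by blast
    then obtain m :: int where "(19 / 4 :: real) = of_int m"
      unfolding shadow_vec_norm by (rule Ints_cases)
    then have "real_of_int 19 = of_int (4 * m)" by simp
    then have "19 = 4 * m" by (simp only: of_int_eq_iff)
    then show False by presburger
  qed
qed

lemma shadow_lattice43_norm_ge:
  assumes "x \<in> lattice43"
  shows "19 / 4 \<le> (shadow_vec + x) \<bullet> (shadow_vec + x)"
proof -
  obtain c where x: "x = half_vec (doubled_coords c)" using assms lattice43_cases by blast
  define u where "u k = shadow_row ! k + doubled_coords c k" for k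
  have su: "shadow_vec + x = half_vec u"
    unfolding x shadow_vec_def add_half_vec u_def ..
  have norm: "(shadow_vec + x) \<bullet> (shadow_vec + x) = of_int (\<Sum>k<43. u k * u k) / 4"
    unfolding su by (simp add: inner_half_vec)
  let ?v = "map (\<lambda>k. map odd shadow_row ! k \<noteq> odd (doubled_coords c k)) [0..<43]"
  have v: "?v = map (\<lambda>k. odd (u k)) [0..<43]"
    by (intro map_cong refl) (auto simp: u_def shadow_row_length)
  have "length (filter id ?v) \<ge> 15"
    by (rule all_comb_doubled_coords[OF shadow_row_coset_weights]) (simp add: shadow_row_length)
  then have ge: "(\<Sum>k<43. u k * u k) \<ge> 15"
    unfolding v length_filter_id_map using card_odd_le_sum_squares[of 43 u] by linarith
  obtain k :: int where k: "2 * (shadow_vec \<bullet> x) - x \<bullet> x = 2 * of_int k"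
    using shadow_vec_characteristic[OF assms] by blast
  obtain m :: int where m: "x \<bullet> x = of_int m"
    using unimodular_inner_Ints[OF unimodular_lattice43 assms assms] by (rule Ints_cases)
  \<comment> \<open>The increment \<open>2 * (s \<bullet> x) + x \<bullet> x\<close> is the even
    number \<open>2 * (s \<bullet> x) - x \<bullet> x\<close> plus twice the norm of
    \<open>x\<close>. Multiplied by 4, the norm is 19 modulo 8, and no integer from 15 to 18 lies in
    that class.\<close>
  have "(shadow_vec + x) \<bullet> (shadow_vec + x) = 19 / 4 + 2 * of_int (k + m)"
    using k m by (simp add: inner_add_left inner_add_right inner_commute shadow_vec_norm)
  then have "real_of_int (\<Sum>k<43. u k * u k) = of_int (19 + 8 * (k + m))"
    unfolding norm by simp
  then have "(\<Sum>k<43. u k * u k) = 19 + 8 * (k + m)" by (simp only: of_int_eq_iff)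
  then have "(\<Sum>k<43. u k * u k) \<ge> 19" using ge by presburger
  then show ?thesis unfolding norm by linarith
qed

lemma min_norm_shadow_lattice43: "min_norm (shadow lattice43) = 19 / 4"
proof (rule min_norm_eqI)
  have "0 \<in> lattice43" unfolding lattice43_def by (auto intro!: exI[of _ "\<lambda>_. 0"])
  then show "shadow_vec \<in> shadow lattice43"
    unfolding shadow_lattice43 by (intro image_eqI[of _ _ 0]) auto
  show "shadow_vec \<noteq> 0" using shadow_vec_norm by auto
qed (use shadow_vec_norm shadow_lattice43_norm_ge in \<open>auto simp: shadow_lattice43\<close>)

theorem proposition4p5:
  "\<exists>L :: (real ^ 43) set. unimodular L \<and> min_norm L = 4 \<and> shadow_sigma L = 19"
  using unimodular_lattice43 min_norm_lattice43 min_norm_shadow_lattice43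
  by (intro exI[of _ lattice43]) (simp add: shadow_sigma_def)

end
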